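(* Let $\eta\in[1,2]$. If $d_1$ and $d_2$ are two $\eta$-squeezed metrics on $V$, then they are locally equivalent, i.e. for every $x\in\mathbb{R}^n$ there are an open neighbourhood $U$ of $x$ and a constant $C>1$ such that $$C^{-1}d_1(y,z)\le d_2(y,z)\le C\,d_1(y,z)\qquad\text{for all }y,z\in U.$$
   Context: Setting: $V$ and $W$ are distributions of $k$-planes and $(n-k)$-planes in $\mathbb{R}^n$ (i.e. maps to the corresponding Grassmannians), spanned at every point by smooth vector fields $X_1,\dots,X_k$ and $X_{k+1},\dots,X_n$ respectively, with $\mathbb{R}^n=V(x)\oplus W(x)$ for every $x$. $\Pi^V_x$ is the projection onto $V(x)$ along $W(x)$ and $\Pi^W_x:=\mathrm{id}-\Pi^V_x$. For $\eta\in[1,2]$, a metric $d$ on $\mathbb{R}^n$ is $\eta$-squeezed on $V$ if for every compact set $K\subset\mathbb{R}^n$ there are constants $C=C(d,K)>1$ and $r=r(d,K)>0$ such that $$C^{-1}\big(|\Pi^V_x[y-x]|+|\Pi^W_x[y-x]|^{1/\eta}\big)\le d(x,y)\le C\big(|\Pi^V_x[y-x]|+|\Pi^W_x[y-x]|^{1/\eta}\big)$$ for every $x\in K$ and every $y\in B_d(x,r)$, the closed $d$-ball of center $x$ and radius $r$.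
   Formalization: Metrics on R^n are additionally assumed to induce the Euclidean topology; without this the 0/1 discrete metric is vacuously η-squeezed, yet it is not locally equivalent to the Euclidean metric, which is 1-squeezed for constant V and W. *)

theory Defs
  imports "HOL-Analysis.Analysis"
begin

(* In finite dimension, f is of class C^(m+1) iff it is differentiable and all its directional
   derivatives are of class C^m. *)
primrec Ck_fun :: "nat \<Rightarrow> (real ^ 'n \<Rightarrow> real ^ 'n) \<Rightarrow> bool" where
  "Ck_fun 0 f \<longleftrightarrow> continuous_on UNIV f"
| "Ck_fun (Suc m) f \<longleftrightarrow>
     (\<forall>x. f differentiable (at x)) \<and>
     (\<forall>v. Ck_fun m (\<lambda>x. frechet_derivative f (at x) v))"

definition smooth_field :: "(real ^ 'n \<Rightarrow> real ^ 'n) \<Rightarrow> bool" where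
  "smooth_field X \<longleftrightarrow> (\<forall>m. Ck_fun m X)"

definition plane_distribution :: "nat \<Rightarrow> (real ^ 'n \<Rightarrow> (real ^ 'n) set) \<Rightarrow> bool" where
  "plane_distribution k V \<longleftrightarrow> (\<forall>x. subspace (V x) \<and> dim (V x) = k)"

definition complementary :: "(real ^ 'n) set \<Rightarrow> (real ^ 'n) set \<Rightarrow> bool" where
  "complementary A B \<longleftrightarrow> A \<inter> B = {0} \<and> {a + b | a b. a \<in> A \<and> b \<in> B} = UNIV"

(* Projection onto A along B; meaningful only for complementary subspaces A and B. *)
definition proj_along :: "(real ^ 'n) set \<Rightarrow> (real ^ 'n) set \<Rightarrow> real ^ 'n \<Rightarrow> real ^ 'n" where
  "proj_along A B v = (THE a. a \<in> A \<and> v - a \<in> B)"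

definition Pi_V ::
    "(real ^ 'n \<Rightarrow> (real ^ 'n) set) \<Rightarrow> (real ^ 'n \<Rightarrow> (real ^ 'n) set) \<Rightarrow>
     real ^ 'n \<Rightarrow> real ^ 'n \<Rightarrow> real ^ 'n" where
  "Pi_V V W x v = proj_along (V x) (W x) v"

definition Pi_W ::
    "(real ^ 'n \<Rightarrow> (real ^ 'n) set) \<Rightarrow> (real ^ 'n \<Rightarrow> (real ^ 'n) set) \<Rightarrow>
     real ^ 'n \<Rightarrow> real ^ 'n \<Rightarrow> real ^ 'n" where
  "Pi_W V W x v = v - Pi_V V W x v"

definition squeeze_gauge ::
    "real \<Rightarrow> (real ^ 'n \<Rightarrow> (real ^ 'n) set) \<Rightarrow> (real ^ 'n \<Rightarrow> (real ^ 'n) set) \<Rightarrow>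
     real ^ 'n \<Rightarrow> real ^ 'n \<Rightarrow> real" where
  "squeeze_gauge \<eta> V W x y =
     norm (Pi_V V W x (y - x)) + norm (Pi_W V W x (y - x)) powr (1 / \<eta>)"

(* A metric on R^n is understood to induce the Euclidean topology. Without this convention
   the 0/1 discrete metric would be squeezed for every eta: its balls of small radius are
   singletons, so the two-sided bound would be void. *)
definition metric_on_Rn :: "(real ^ 'n \<Rightarrow> real ^ 'n \<Rightarrow> real) \<Rightarrow> bool" where
  "metric_on_Rn d \<longleftrightarrow> Metric_space UNIV d \<and> Metric_space.mtopology UNIV d = euclidean"

definition squeezed ::
    "real \<Rightarrow> (real ^ 'n \<Rightarrow> (real ^ 'n) set) \<Rightarrow> (real ^ 'n \<Rightarrow> (real ^ 'n) set) \<Rightarrow>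
     (real ^ 'n \<Rightarrow> real ^ 'n \<Rightarrow> real) \<Rightarrow> bool" where
  "squeezed \<eta> V W d \<longleftrightarrow>
     (\<forall>K. compact K \<longrightarrow>
       (\<exists>C>1. \<exists>r>0. \<forall>x\<in>K. \<forall>y\<in>Metric_space.mcball UNIV d x r.
          inverse C * squeeze_gauge \<eta> V W x y \<le> d x y \<and>
          d x y \<le> C * squeeze_gauge \<eta> V W x y))"

end

theory Submission
  imports Defs
begin

text \<open>
  The squeeze gauge is determined by the two distributions and the exponent alone, so two squeezed
  metrics are comparable because each is comparable to the same gauge. What needs an argument is the range of the comparison.
  Squeezing compares a metric with the gauge between a point of a compact set and the points of a
  small ball of that metric around it. The lemma \<open>squeezed_gauge_bounds_near\<close> turns this
  into a comparison at all pairs of points of a single Euclidean neighbourhood; this is where the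
  metric inducing the Euclidean topology enters. On the intersection of the neighbourhoods of the
  two metrics, the product of their constants serves.
\<close>

text \<open>
  By the triangle inequality any two points of the ball of half the squeezing radius lie within
  the squeezing radius of each other, and that ball is open because the metric induces the
  Euclidean topology. Cutting it down to a bounded set allows one compact set to supply the
  constants for all base points at once.
\<close>
lemma squeezed_gauge_bounds_near:
  fixes d :: "real ^ 'n \<Rightarrow> real ^ 'n \<Rightarrow> real"
  assumes "metric_on_Rn d" and "squeezed \<eta> V W d"
  obtains U C where "open U" "x \<in> U" "C > 1"
    "\<And>y z. y \<in> U \<Longrightarrow> z \<in> U \<Longrightarrow>
       inverse C * squeeze_gauge \<eta> V W y z \<le> d y z \<and> d y z \<le> C * squeeze_gauge \<eta> V W y z"
proof -
  interpret d: Metric_space UNIV d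
    using assms(1) by (simp add: metric_on_Rn_def)
  have "compact (cball x 1)"
    by simp
  then obtain C r where "C > 1" "r > 0" and
    bounds: "\<And>y z. y \<in> cball x 1 \<Longrightarrow> z \<in> d.mcball y r \<Longrightarrow>
       inverse C * squeeze_gauge \<eta> V W y z \<le> d y z \<and> d y z \<le> C * squeeze_gauge \<eta> V W y z"
    using assms(2) unfolding squeezed_def by meson
  define U where "U = ball x 1 \<inter> d.mball x (r / 2)"
  have "open (d.mball x (r / 2))"
    using d.openin_mball assms(1) by (metis metric_on_Rn_def open_openin)
  then have "open U"
    by (simp add: U_def open_Int)
  moreover have "x \<in> U"
    using \<open>r > 0\<close> by (simp add: U_def)
  moreover have "z \<in> d.mcball y r" if "y \<in> U" "z \<in> U" for y z
  proof -
    have "d y z \<le> d x y + d x z"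
      using d.triangle[of y x z] d.commute[of y x] by simp
    with that show ?thesis
      by (simp add: U_def)
  qed
  moreover have "U \<subseteq> cball x 1"
    by (auto simp: U_def)
  ultimately show thesis
    using that[of U C] bounds \<open>C > 1\<close> by blast
qed

theorem proposition5p1p3:
  fixes V W :: "real ^ 'n \<Rightarrow> (real ^ 'n) set"
    and X :: "nat \<Rightarrow> real ^ 'n \<Rightarrow> real ^ 'n"
    and k :: nat and \<eta> :: real
    and d1 d2 :: "real ^ 'n \<Rightarrow> real ^ 'n \<Rightarrow> real"
  assumes "k \<le> CARD('n)"
    and "plane_distribution k V"
    and "plane_distribution (CARD('n) - k) W"
    and "\<And>i. i \<in> {1..CARD('n)} \<Longrightarrow> smooth_field (X i)"
    and "\<And>x. V x = span ((\<lambda>i. X i x) ` {1..k})"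
    and "\<And>x. W x = span ((\<lambda>i. X i x) ` {k+1..CARD('n)})"
    and "\<And>x. complementary (V x) (W x)"
    and "1 \<le> \<eta>" and "\<eta> \<le> 2"
    and "metric_on_Rn d1" and "squeezed \<eta> V W d1"
    and "metric_on_Rn d2" and "squeezed \<eta> V W d2"
  shows "\<forall>x. \<exists>U C. open U \<and> x \<in> U \<and> C > 1 \<and>
           (\<forall>y\<in>U. \<forall>z\<in>U. inverse C * d1 y z \<le> d2 y z \<and> d2 y z \<le> C * d1 y z)"
proof
  fix x
  obtain U1 C1 where U1: "open U1" "x \<in> U1" and "C1 > 1" and
    b1: "\<And>y z. y \<in> U1 \<Longrightarrow> z \<in> U1 \<Longrightarrow> inverse C1 * squeeze_gauge \<eta> V W y z \<le> d1 y z
           \<and> d1 y z \<le> C1 * squeeze_gauge \<eta> V W y z"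
    using squeezed_gauge_bounds_near[OF \<open>metric_on_Rn d1\<close> \<open>squeezed \<eta> V W d1\<close>] by blast
  obtain U2 C2 where U2: "open U2" "x \<in> U2" and "C2 > 1" and
    b2: "\<And>y z. y \<in> U2 \<Longrightarrow> z \<in> U2 \<Longrightarrow> inverse C2 * squeeze_gauge \<eta> V W y z \<le> d2 y z
           \<and> d2 y z \<le> C2 * squeeze_gauge \<eta> V W y z"
    using squeezed_gauge_bounds_near[OF \<open>metric_on_Rn d2\<close> \<open>squeezed \<eta> V W d2\<close>] by blast
  have compare: "b \<le> C * D * a"
    if "inverse C * g \<le> a" "b \<le> D * g" "C > 1" "D > 1" for a b g C D :: real
  proof -
    have "g \<le> C * a"
      using that by (simp add: field_simps)
    then have "D * g \<le> D * (C * a)"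
      using that by simp
    with \<open>b \<le> D * g\<close> have "b \<le> D * (C * a)"
      by (rule order_trans)
    then show ?thesis
      by (simp only: ac_simps)
  qed
  have "inverse (C1 * C2) * d1 y z \<le> d2 y z \<and> d2 y z \<le> C1 * C2 * d1 y z"
    if "y \<in> U1 \<inter> U2" "z \<in> U1 \<inter> U2" for y z
  proof
    note b = b1[of y z] b2[of y z]
    show "d2 y z \<le> C1 * C2 * d1 y z"
      using compare b that \<open>C1 > 1\<close> \<open>C2 > 1\<close> by blast
    have "d1 y z \<le> C2 * C1 * d2 y z"
      using compare b that \<open>C1 > 1\<close> \<open>C2 > 1\<close> by blast
    then show "inverse (C1 * C2) * d1 y z \<le> d2 y z"
      using \<open>C1 > 1\<close> \<open>C2 > 1\<close> by (simp add: field_simps)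
  qed
  moreover have "C1 * C2 > 1"
    using \<open>C1 > 1\<close> \<open>C2 > 1\<close> by (rule less_1_mult)
  moreover have "open (U1 \<inter> U2)" "x \<in> U1 \<inter> U2"
    using U1 U2 by auto
  ultimately show "\<exists>U C. open U \<and> x \<in> U \<and> C > 1 \<and>
      (\<forall>y\<in>U. \<forall>z\<in>U. inverse C * d1 y z \<le> d2 y z \<and> d2 y z \<le> C * d1 y z)"
    by blast
qed

end
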